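(* Let $X$ be a non-compact locally compact Cantor set and let $\mu \in M^0(X)$ be a good measure. Let $cX$ be any compactification of $X$ that is a Cantor set, and extend $\mu$ to $cX$ by giving the remainder $cX\setminus X$ measure zero; denote the extension by $\mu|_{cX}$. Then $\mu|_{cX}$ is good on $cX$ if and only if $S(\mu|_{cX}) \cap [0, \mu(X)) = S(\mu|_X)$, where $\mu|_X=\mu$ is the original measure on $X$.
   Context: A Cantor set is a non-empty zero-dimensional compact perfect metric space. A non-compact locally compact Cantor set is a non-compact locally compact metrizable space with no isolated points and with a countable basis of compact open sets. For a locally compact Cantor set $X$ (compact or non-compact), $M(X)$ is the set of Borel measures (finite or infinite) on $X$ that are full (every non-empty open set has positive measure) and non-atomic. For an infinite $\mu\in M(X)$ the defective set is $\mathfrak{M}_\mu = \{x \in X : \mu(U)=\infty \text{ for every compact open } U \ni x\}$, and $\mu$ is non-defective if $\mu(\mathfrak{M}_\mu)=0$. $M^0(X)$ is the set of $\mu\in M(X)$ that are either finite (normalized so that $\mu(X)=1$) or infinite and non-defective. The compact open values set is $S(\mu)=\{\mu(U): U \text{ compact open in } X,\ \mu(U)<\infty\}$. $\mu\in M^0(X)$ is good if for all compact open $U,V\subset X$ with $\mu(U)<\mu(V)$ there is a compact open $W\subset V$ with $\mu(W)=\mu(U)$. A compactification $cX$ of $X$ is a compact space containing (a homeomorphic copy of) $X$ as a dense subset. *)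

theory Defs
  imports "HOL-Analysis.Analysis"
begin

definition no_isolated_points :: "'a topology \<Rightarrow> bool" where
  "no_isolated_points X \<longleftrightarrow> (\<forall>x \<in> topspace X. \<not> openin X {x})"

definition compact_open :: "'a topology \<Rightarrow> 'a set \<Rightarrow> bool" where
  "compact_open X U \<longleftrightarrow> compactin X U \<and> openin X U"

definition Cantor_set :: "'a topology \<Rightarrow> bool" where
  "Cantor_set X \<longleftrightarrow>
     topspace X \<noteq> {} \<and> X dim_le 0 \<and> compact_space X \<and> no_isolated_points X \<and> metrizable_space X"

definition noncompact_locally_compact_Cantor_set :: "'a topology \<Rightarrow> bool" where
  "noncompact_locally_compact_Cantor_set X \<longleftrightarrow>
     \<not> compact_space X \<and> locally_compact_space X \<and> metrizable_space X \<and> no_isolated_points X \<and>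
     (\<exists>\<B>. countable \<B> \<and> (\<forall>V \<in> \<B>. compact_open X V) \<and>
          (\<forall>U x. openin X U \<and> x \<in> U \<longrightarrow> (\<exists>V \<in> \<B>. x \<in> V \<and> V \<subseteq> U)))"

text \<open>The Borel \<open>\<sigma>\<close>-algebra of a topology with an explicit carrier (the library's
  \<^const>\<open>borel\<close> is tied to a type class). Only its underlying \<open>\<sigma>\<close>-algebra is relevant.\<close>

definition borel_of :: "'a topology \<Rightarrow> 'a measure" where
  "borel_of X = sigma (topspace X) {U. openin X U}"

lemma space_borel_of [simp]: "space (borel_of X) = topspace X"
  unfolding borel_of_def by (rule space_measure_of) (auto dest: openin_subset)

lemma sets_borel_of: "sets (borel_of X) = sigma_sets (topspace X) {U. openin X U}"
  unfolding borel_of_def by (rule sets_measure_of) (auto dest: openin_subset)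

lemma measurable_borel_of:
  assumes "continuous_map X Y f"
  shows "f \<in> measurable (borel_of X) (borel_of Y)"
  unfolding borel_of_def [of Y]
proof (rule measurable_measure_of)
  show "{U. openin Y U} \<subseteq> Pow (topspace Y)"
    by (auto dest: openin_subset)
  show "f \<in> space (borel_of X) \<rightarrow> topspace Y"
    using assms by (auto simp: continuous_map_def)
next
  fix U assume "U \<in> {U. openin Y U}"
  then have "openin X {x \<in> topspace X. f x \<in> U}"
    using assms by (auto simp: continuous_map_def)
  moreover have "f -` U \<inter> space (borel_of X) = {x \<in> topspace X. f x \<in> U}"
    by auto
  ultimately show "f -` U \<inter> space (borel_of X) \<in> sets (borel_of X)"
    by (simp add: sets_borel_of sigma_sets.Basic)
qed

definition full_measure :: "'a topology \<Rightarrow> 'a measure \<Rightarrow> bool" where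
  "full_measure X \<mu> \<longleftrightarrow> (\<forall>U. openin X U \<and> U \<noteq> {} \<longrightarrow> 0 < emeasure \<mu> U)"

definition atom :: "'a measure \<Rightarrow> 'a set \<Rightarrow> bool" where
  "atom \<mu> A \<longleftrightarrow> A \<in> sets \<mu> \<and> 0 < emeasure \<mu> A \<and>
     (\<forall>B \<in> sets \<mu>. B \<subseteq> A \<and> emeasure \<mu> B < emeasure \<mu> A \<longrightarrow> emeasure \<mu> B = 0)"

definition nonatomic :: "'a measure \<Rightarrow> bool" where
  "nonatomic \<mu> \<longleftrightarrow> (\<nexists>A. atom \<mu> A)"

definition M :: "'a topology \<Rightarrow> 'a measure set" where
  "M X = {\<mu>. sets \<mu> = sets (borel_of X) \<and> full_measure X \<mu> \<and> nonatomic \<mu>}"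

definition defective_set :: "'a topology \<Rightarrow> 'a measure \<Rightarrow> 'a set" where
  "defective_set X \<mu> =
     {x \<in> topspace X. \<forall>U. compact_open X U \<and> x \<in> U \<longrightarrow> emeasure \<mu> U = \<infinity>}"

text \<open>We require membership in \<^const>\<open>null_sets\<close> because \<^const>\<open>emeasure\<close> is \<open>0\<close>
  on non-measurable sets. In the spaces considered here the defective set is closed.\<close>

definition nondefective :: "'a topology \<Rightarrow> 'a measure \<Rightarrow> bool" where
  "nondefective X \<mu> \<longleftrightarrow> defective_set X \<mu> \<in> null_sets \<mu>"

definition M0 :: "'a topology \<Rightarrow> 'a measure set" where
  "M0 X = {\<mu> \<in> M X. emeasure \<mu> (topspace X) = 1 \<or>
                    (emeasure \<mu> (topspace X) = \<infinity> \<and> nondefective X \<mu>)}"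

definition compact_open_values :: "'a topology \<Rightarrow> 'a measure \<Rightarrow> ennreal set" where
  "compact_open_values X \<mu> = {emeasure \<mu> U | U. compact_open X U \<and> emeasure \<mu> U < \<infinity>}"

definition good :: "'a topology \<Rightarrow> 'a measure \<Rightarrow> bool" where
  "good X \<mu> \<longleftrightarrow> \<mu> \<in> M0 X \<and>
     (\<forall>U V. compact_open X U \<and> compact_open X V \<and> emeasure \<mu> U < emeasure \<mu> V \<longrightarrow>
        (\<exists>W. compact_open X W \<and> W \<subseteq> V \<and> emeasure \<mu> W = emeasure \<mu> U))"

definition compactification :: "'a topology \<Rightarrow> 'b topology \<Rightarrow> ('a \<Rightarrow> 'b) \<Rightarrow> bool" where
  "compactification X cX \<iota> \<longleftrightarrow>
     compact_space cX \<and> embedding_map X cX \<iota> \<and> cX closure_of (\<iota> ` topspace X) = topspace cX"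

text \<open>The extension by zero along an embedding \<open>\<iota>\<close> assigns to a Borel set \<open>B\<close> of \<open>cX\<close> the
  \<open>\<mu>\<close>-measure of its trace on \<open>X\<close>, so the remainder receives measure \<open>0\<close>;
  see \<open>emeasure_zero_extension\<close>.\<close>

definition zero_extension ::
    "'a topology \<Rightarrow> 'b topology \<Rightarrow> ('a \<Rightarrow> 'b) \<Rightarrow> 'a measure \<Rightarrow> 'b measure" where
  "zero_extension X cX \<iota> \<mu> = distr \<mu> (borel_of cX) \<iota>"

lemma emeasure_zero_extension:
  assumes "compactification X cX \<iota>" "sets \<mu> = sets (borel_of X)" "B \<in> sets (borel_of cX)"
  shows "emeasure (zero_extension X cX \<iota> \<mu>) B = emeasure \<mu> {x \<in> topspace X. \<iota> x \<in> B}"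
proof -
  have "continuous_map X cX \<iota>"
    using assms(1) homeomorphic_imp_continuous_map continuous_map_into_fulltopology
    unfolding compactification_def embedding_map_def by blast
  then have "\<iota> \<in> measurable \<mu> (borel_of cX)"
    using measurable_borel_of measurable_cong_sets[OF assms(2) refl] by blast
  moreover have "\<iota> -` B \<inter> space \<mu> = {x \<in> topspace X. \<iota> x \<in> B}"
    using sets_eq_imp_space_eq[OF assms(2)] by auto
  ultimately show ?thesis
    using assms(3) by (simp add: zero_extension_def emeasure_distr)
qed

end

theory Submission
  imports Defs
begin

text \<open>A locally compact dense subset of a Hausdorff space is open, so \<open>X\<close> sits in \<open>cX\<close> as an open
  set and the compact open subsets of \<open>X\<close> are exactly the compact open subsets of \<open>cX\<close> that lie
  inside \<open>X\<close>. Hence the extension is always in \<open>M\<^sup>0(cX)\<close>, and only the subset condition matters.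
  The measure of any open set is the supremum of the measures of its compact open subsets.
  If \<open>cX\<close> is good, a value \<open>\<gamma> < \<mu>(X)\<close> is therefore exceeded by some compact open subset
  of \<open>X\<close>, inside which goodness finds a compact open set of measure \<open>\<gamma>\<close>. Conversely, if a value
  \<open>\<mu>(U) < \<mu>(V)\<close> on \<open>cX\<close> is already attained in \<open>X\<close>, then goodness of \<open>\<mu>\<close> applies inside a compact
  open subset of \<open>V \<inter> X\<close> of measure greater than \<open>\<mu>(U)\<close>.\<close>

section \<open>Transport of open, compact open and Borel sets along the embedding\<close>

lemma openin_in_sets_borel_of: "openin X U \<Longrightarrow> U \<in> sets (borel_of X)"
  by (simp add: sets_borel_of sigma_sets.Basic)

lemma embedding_map_imp_continuous_map: "embedding_map X Y f \<Longrightarrow> continuous_map X Y f"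
  unfolding embedding_map_def
  using homeomorphic_imp_continuous_map continuous_map_into_fulltopology by blast

lemma embedding_map_imp_inj_on: "embedding_map X Y f \<Longrightarrow> inj_on f (topspace X)"
  unfolding embedding_map_def by (rule homeomorphic_imp_injective_map)

text \<open>The image of \<open>f\<close> is homeomorphic to \<open>X\<close>, hence locally
  compact; being dense in a Hausdorff space it is open. This openness carries compact open and Borel
  sets of \<open>X\<close> over to \<open>Y\<close>.\<close>

lemma compactification_imp_open_map:
  assumes "compactification X Y f" "locally_compact_space X" "Hausdorff_space Y"
  shows "open_map X Y f"
proof -
  have emb: "embedding_map X Y f" and dense: "Y closure_of (f ` topspace X) = topspace Y"
    using assms(1) by (auto simp: compactification_def)
  have hom: "homeomorphic_map X (subtopology Y (f ` topspace X)) f"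
    using emb by (simp add: embedding_map_def)
  then have "locally_compact_space (subtopology Y (f ` topspace X))"
    using assms(2) homeomorphic_locally_compact_spaceD homeomorphic_map_imp_homeomorphic_space
    by blast
  moreover have "f ` topspace X \<subseteq> topspace Y"
    using embedding_map_imp_continuous_map[OF emb] continuous_map_image_subset_topspace by blast
  ultimately have "openin Y (f ` topspace X)"
    using dense_locally_compact_openin_Hausdorff_space[OF assms(3)] dense by blast
  then show ?thesis
    using hom homeomorphic_imp_open_map open_map_from_open_subtopology by blast
qed

lemma compact_open_image:
  assumes "continuous_map X Y f" "open_map X Y f" "compact_open X U"
  shows "compact_open Y (f ` U)"
  using assms image_compactin by (auto simp: compact_open_def open_map_def)

text \<open>The way back from \<open>Y\<close> to \<open>X\<close>. A compact \<open>W\<close> that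
  reaches outside the image would have a trace that is open but possibly not compact; inside the
  image the homeomorphism applies.\<close>

lemma compact_open_vimage_embedding:
  assumes "embedding_map X Y f" "compact_open Y W" "W \<subseteq> f ` topspace X"
  shows "compact_open X {x \<in> topspace X. f x \<in> W}"
proof -
  have hom: "homeomorphic_map X (subtopology Y (f ` topspace X)) f"
    using assms(1) by (simp add: embedding_map_def)
  have "f ` {x \<in> topspace X. f x \<in> W} = W"
    using assms(3) by auto
  then have "compactin X {x \<in> topspace X. f x \<in> W}"
    using homeomorphic_map_compactness[OF hom, of "{x \<in> topspace X. f x \<in> W}"] assms(2,3)
    by (auto simp: compactin_subtopology compact_open_def)
  moreover have "openin X {x \<in> topspace X. f x \<in> W}"
    using embedding_map_imp_continuous_map[OF assms(1)] assms(2)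
    by (auto simp: compact_open_def continuous_map_def)
  ultimately show ?thesis
    by (simp add: compact_open_def)
qed

text \<open>Induction over the generated \<sigma>-algebra. Injectivity lets the image commute with
  complements, and the complement is Borel because the whole image of \<open>X\<close> is
  open.\<close>

lemma borel_of_image_open_embedding:
  assumes "inj_on f (topspace X)" "open_map X Y f" "B \<in> sets (borel_of X)"
  shows "f ` B \<in> sets (borel_of Y)"
proof -
  have op: "f ` U \<in> sets (borel_of Y)" if "openin X U" for U
    using that assms(2) by (auto simp: open_map_def intro: openin_in_sets_borel_of)
  have "B \<in> sigma_sets (topspace X) {U. openin X U}"
    using assms(3) by (simp add: sets_borel_of)
  then show ?thesis
  proof induction
    case (Compl A)
    have "A \<subseteq> topspace X"
      using Compl.hyps by (rule sigma_sets_into_sp[rotated]) (auto dest: openin_subset)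
    then have "f ` (topspace X - A) = f ` topspace X - f ` A"
      using assms(1) by (simp add: inj_on_image_set_diff[where C="topspace X"])
    then show ?case
      using Compl.IH op[OF openin_topspace] by auto
  next
    case (Union A)
    then show ?case by (auto simp: image_UN)
  qed (auto intro: op)
qed

section \<open>Measures of open sets and of compact open subsets\<close>

lemma compact_open_UN_finite:
  assumes "finite I" "\<And>i. i \<in> I \<Longrightarrow> compact_open X (A i)"
  shows "compact_open X (\<Union>i\<in>I. A i)"
  using assms unfolding compact_open_def by (auto intro!: compactin_Union)

text \<open>The base members inside \<open>V\<close> are countably many and cover \<open>V\<close>.
  Their finite unions are compact open and increase to \<open>V\<close>, so continuity from below
  applies, even if \<open>V\<close> has infinite measure.\<close>

lemma openin_less_emeasure_compact_open:
  assumes X: "noncompact_locally_compact_Cantor_set X"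
    and sets: "sets \<mu> = sets (borel_of X)" and V: "openin X V" and c: "c < emeasure \<mu> V"
  obtains W where "compact_open X W" "W \<subseteq> V" "c < emeasure \<mu> W"
proof -
  obtain \<B> where \<B>: "countable \<B>" "\<forall>B\<in>\<B>. compact_open X B"
    and base: "\<forall>U x. openin X U \<and> x \<in> U \<longrightarrow> (\<exists>B\<in>\<B>. x \<in> B \<and> B \<subseteq> U)"
    using X unfolding noncompact_locally_compact_Cantor_set_def by (elim conjE exE)
  define \<C> where "\<C> = {B \<in> \<B>. B \<subseteq> V}"
  have "V = \<Union>\<C>"
    using base V unfolding \<C>_def by blast
  \<comment> \<open>\<open>from_nat_into\<close> enumerates only a nonempty family; \<open>V\<close>
    is nonempty since \<open>c\<close> is strictly below its measure.\<close>
  moreover have "V \<noteq> {}"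
    using c by auto
  ultimately have ne: "\<C> \<noteq> {}" by auto
  have "countable \<C>"
    using \<B>(1) by (auto simp: \<C>_def)
  define W where "W n = (\<Union>i\<in>{..n}. from_nat_into \<C> i)" for n :: nat
  have in\<C>: "from_nat_into \<C> i \<in> \<C>" for i
    using ne by (rule from_nat_into)
  have W: "compact_open X (W n)" for n
    unfolding W_def using in\<C> \<B>(2) by (intro compact_open_UN_finite) (auto simp: \<C>_def)
  have sub: "W n \<subseteq> V" for n
    using in\<C> by (auto simp: W_def \<C>_def)
  have "(\<Union>n. W n) = (\<Union>i. from_nat_into \<C> i)"
    by (auto simp: W_def)
  also have "\<dots> = V"
    using \<open>V = \<Union>\<C>\<close> range_from_nat_into[OF ne \<open>countable \<C>\<close>] by simp
  finally have UN: "(\<Union>n. W n) = V" .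
  have "range W \<subseteq> sets \<mu>"
    using W by (auto simp: compact_open_def sets openin_in_sets_borel_of)
  moreover have "incseq W"
    by (fastforce simp: incseq_def W_def)
  ultimately have "(SUP n. emeasure \<mu> (W n)) = emeasure \<mu> V"
    using SUP_emeasure_incseq UN by metis
  then obtain n where "c < emeasure \<mu> (W n)"
    using c by (metis less_SUP_iff)
  then show thesis
    using that W sub by blast
qed

text \<open>As \<open>X\<close> is not compact, the complement of \<open>U\<close> is open and
  nonempty, so it has positive measure; finiteness of \<open>emeasure \<mu> U\<close> keeps the
  inequality strict.\<close>

lemma emeasure_compact_open_less_topspace:
  assumes "\<not> compact_space X" "Hausdorff_space X" "sets \<mu> = sets (borel_of X)"
    and "full_measure X \<mu>" "compact_open X U" "emeasure \<mu> U < \<infinity>"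
  shows "emeasure \<mu> U < emeasure \<mu> (topspace X)"
proof -
  have U: "compactin X U" "openin X U" "U \<subseteq> topspace X"
    using assms(5) compactin_subset_topspace by (auto simp: compact_open_def)
  have op: "openin X (topspace X - U)"
    using compactin_imp_closedin[OF assms(2) U(1)] by blast
  moreover have "topspace X - U \<noteq> {}"
    using U assms(1) by (metis Diff_eq_empty_iff compact_space_def subset_antisym)
  ultimately have "0 < emeasure \<mu> (topspace X - U)"
    using assms(4) by (auto simp: full_measure_def)
  moreover have "emeasure \<mu> (topspace X) = emeasure \<mu> U + emeasure \<mu> (topspace X - U)"
    using plus_emeasure[of U \<mu> "topspace X - U"] U op assms(3)
    by (simp add: openin_in_sets_borel_of Un_absorb1)
  ultimately show ?thesis
    using assms(6) by (simp add: ennreal_add_left_cancel_less less_top[symmetric])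
qed

section \<open>Membership of the zero extension in \<open>M0\<close>\<close>

text \<open>The trace on \<open>X\<close> of an atom \<open>A\<close> would be an atom of \<mu>: a
  measurable subset of the trace has as image a Borel subset of \<open>A\<close> of the same
  measure.\<close>

lemma nonatomic_zero_extension:
  assumes cpt: "compactification X Y f" and "open_map X Y f"
    and sets: "sets \<mu> = sets (borel_of X)" and "nonatomic \<mu>"
  shows "nonatomic (zero_extension X Y f \<mu>)"
  unfolding nonatomic_def
proof
  let ?\<nu> = "zero_extension X Y f \<mu>"
  assume "\<exists>A. atom ?\<nu> A"
  then obtain A where A: "A \<in> sets (borel_of Y)" "0 < emeasure ?\<nu> A"
    and min: "\<And>B. \<lbrakk>B \<in> sets (borel_of Y); B \<subseteq> A; emeasure ?\<nu> B < emeasure ?\<nu> A\<rbrakk> \<Longrightarrow> emeasure ?\<nu> B = 0"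
    by (auto simp: atom_def zero_extension_def)
  note em = emeasure_zero_extension[OF cpt sets]
  have emb: "embedding_map X Y f"
    using cpt by (simp add: compactification_def)
  note inj = embedding_map_imp_inj_on[OF emb]
  let ?T = "{x \<in> topspace X. f x \<in> A}"
  have "?T \<in> sets \<mu>"
    using measurable_sets[OF measurable_borel_of[OF embedding_map_imp_continuous_map[OF emb]] A(1)]
    by (simp add: sets vimage_def Int_def conj_commute)
  moreover have "emeasure \<mu> B = 0"
    if B: "B \<in> sets \<mu>" "B \<subseteq> ?T" "emeasure \<mu> B < emeasure \<mu> ?T" for B
  proof -
    have fB: "f ` B \<in> sets (borel_of Y)"
      using borel_of_image_open_embedding[OF inj assms(2)] B(1) sets by simp
    have "{x \<in> topspace X. f x \<in> f ` B} = B"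
      using inj B(2) by (auto dest: inj_onD)
    then have "emeasure ?\<nu> (f ` B) = emeasure \<mu> B"
      using em[OF fB] by simp
    then show ?thesis
      using min[OF fB] B em[OF A(1)] by auto
  qed
  ultimately have "atom \<mu> ?T"
    using A em[OF A(1)] by (auto simp: atom_def)
  then show False
    using assms(4) by (auto simp: nonatomic_def)
qed

text \<open>Any defective point of \<open>Y\<close> in the image comes from a defective point of
  \<open>X\<close>, since compact open neighbourhoods in \<open>X\<close> have compact open images
  of equal measure. The remainder is null.\<close>

lemma nondefective_zero_extension:
  assumes cpt: "compactification X Y f" and "open_map X Y f"
    and sets: "sets \<mu> = sets (borel_of X)" and "nondefective X \<mu>"
  shows "nondefective Y (zero_extension X Y f \<mu>)"
proof -
  let ?\<nu> = "zero_extension X Y f \<mu>"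
  let ?D = "defective_set Y ?\<nu>"
  note em = emeasure_zero_extension[OF cpt sets]
  have emb: "embedding_map X Y f"
    using cpt by (simp add: compactification_def)
  note inj = embedding_map_imp_inj_on[OF emb]
  \<comment> \<open>The defective set is closed, hence Borel, so its measure may be computed from
    its trace.\<close>
  have "?D = topspace Y - \<Union>{U. compact_open Y U \<and> emeasure ?\<nu> U \<noteq> \<infinity>}"
    by (auto simp: defective_set_def)
  moreover have "openin Y (\<Union>{U. compact_open Y U \<and> emeasure ?\<nu> U \<noteq> \<infinity>})"
    by (rule openin_Union) (auto simp: compact_open_def)
  ultimately have D: "?D \<in> sets (borel_of Y)"
    by (metis openin_in_sets_borel_of sets.compl_sets space_borel_of)
  have "{x \<in> topspace X. f x \<in> ?D} \<subseteq> defective_set X \<mu>"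
  proof
    fix x assume x: "x \<in> {x \<in> topspace X. f x \<in> ?D}"
    have "emeasure \<mu> U = \<infinity>" if U: "compact_open X U" "x \<in> U" for U
    proof -
      have fU: "compact_open Y (f ` U)"
        using compact_open_image[OF embedding_map_imp_continuous_map[OF emb] assms(2) U(1)] .
      then have "emeasure ?\<nu> (f ` U) = \<infinity>"
        using x U(2) by (auto simp: defective_set_def)
      moreover have "{x \<in> topspace X. f x \<in> f ` U} = U"
        using inj U(1) by (auto simp: compact_open_def dest: inj_onD openin_subset)
      ultimately show ?thesis
        using em[of "f ` U"] fU by (simp add: compact_open_def openin_in_sets_borel_of)
    qed
    then show "x \<in> defective_set X \<mu>"
      using x by (simp add: defective_set_def)
  qed
  then have "emeasure \<mu> {x \<in> topspace X. f x \<in> ?D} \<le> emeasure \<mu> (defective_set X \<mu>)"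
    using assms(4) by (intro emeasure_mono) (auto simp: nondefective_def)
  then have "emeasure ?\<nu> ?D = 0"
    using assms(4) em[OF D] by (auto simp: nondefective_def null_sets_def)
  then show ?thesis
    using D by (simp add: nondefective_def null_sets_def zero_extension_def)
qed

text \<open>Density gives fullness, because every nonempty open set of \<open>Y\<close> has a
  nonempty open trace. The total mass is unchanged, so the finite and infinite cases are
  preserved.\<close>

lemma zero_extension_in_M0:
  assumes cpt: "compactification X Y f" and "open_map X Y f" and "\<mu> \<in> M0 X"
  shows "zero_extension X Y f \<mu> \<in> M0 Y"
proof -
  let ?\<nu> = "zero_extension X Y f \<mu>"
  have sets: "sets \<mu> = sets (borel_of X)" and full: "full_measure X \<mu>" and na: "nonatomic \<mu>"
    using assms(3) by (auto simp: M0_def M_def)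
  note em = emeasure_zero_extension[OF cpt sets]
  have cont: "continuous_map X Y f" and dense: "Y closure_of (f ` topspace X) = topspace Y"
    using cpt embedding_map_imp_continuous_map by (auto simp: compactification_def)
  have "full_measure Y ?\<nu>"
    unfolding full_measure_def
  proof (intro allI impI, elim conjE)
    fix U assume U: "openin Y U" "U \<noteq> {}"
    then have "f ` topspace X \<inter> U \<noteq> {}"
      using dense by (simp add: dense_intersects_open)
    then have "{x \<in> topspace X. f x \<in> U} \<noteq> {}" by auto
    moreover have "openin X {x \<in> topspace X. f x \<in> U}"
      using cont U(1) by (auto simp: continuous_map_def)
    ultimately show "0 < emeasure ?\<nu> U"
      using full em[OF openin_in_sets_borel_of[OF U(1)]] by (auto simp: full_measure_def)
  qed
  moreover have "emeasure ?\<nu> (topspace Y) = emeasure \<mu> (topspace X)"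
  proof -
    have "{x \<in> topspace X. f x \<in> topspace Y} = topspace X"
      using cont by (auto simp: continuous_map_def)
    then show ?thesis
      using em[OF openin_in_sets_borel_of[OF openin_topspace]] by simp
  qed
  ultimately show ?thesis
    using assms(3) nonatomic_zero_extension[OF cpt assms(2) sets na]
      nondefective_zero_extension[OF cpt assms(2) sets]
    by (auto simp: M0_def M_def zero_extension_def)
qed

theorem theorem3p3:
  fixes X :: "'a topology" and cX :: "'b topology" and \<iota> :: "'a \<Rightarrow> 'b" and \<mu> :: "'a measure"
  assumes "noncompact_locally_compact_Cantor_set X"
    and "\<mu> \<in> M0 X" and "good X \<mu>"
    and "compactification X cX \<iota>" and "Cantor_set cX"
  shows "good cX (zero_extension X cX \<iota> \<mu>) \<longleftrightarrow>
         compact_open_values cX (zero_extension X cX \<iota> \<mu>) \<inter> {0..<emeasure \<mu> (topspace X)}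
           = compact_open_values X \<mu>"
proof -
  let ?\<nu> = "zero_extension X cX \<iota> \<mu>"
  let ?T = "\<lambda>B. {x \<in> topspace X. \<iota> x \<in> B}"
  have X: "\<not> compact_space X" "locally_compact_space X" "Hausdorff_space X"
    using assms(1) metrizable_imp_Hausdorff_space
    by (auto simp: noncompact_locally_compact_Cantor_set_def)
  have op: "open_map X cX \<iota>"
    using compactification_imp_open_map[OF assms(4) X(2)] assms(5) metrizable_imp_Hausdorff_space
    by (auto simp: Cantor_set_def)
  have emb: "embedding_map X cX \<iota>"
    using assms(4) by (simp add: compactification_def)
  have cont: "continuous_map X cX \<iota>"
    using emb by (rule embedding_map_imp_continuous_map)
  have sets: "sets \<mu> = sets (borel_of X)" and full: "full_measure X \<mu>"
    using assms(2) by (auto simp: M0_def M_def)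
  have em: "emeasure ?\<nu> U = emeasure \<mu> (?T U)" if "compact_open cX U" for U
    using that emeasure_zero_extension[OF assms(4) sets] openin_in_sets_borel_of
    by (auto simp: compact_open_def)
  have img: "compact_open cX (\<iota> ` U)" if "compact_open X U" for U
    using compact_open_image[OF cont op that] .
  have emi: "emeasure ?\<nu> (\<iota> ` U) = emeasure \<mu> U" if "compact_open X U" for U
  proof -
    have "?T (\<iota> ` U) = U"
      using embedding_map_imp_inj_on[OF emb] that
      by (auto simp: compact_open_def dest: inj_onD openin_subset)
    then show ?thesis
      using em[OF img[OF that]] by simp
  qed
  have traceo: "openin X (?T V)" if "compact_open cX V" for V
    using cont that by (auto simp: compact_open_def continuous_map_def)
  \<comment> \<open>This inclusion holds whether or not the extension is good: the image of
    \<open>U\<close> realizes the same value.\<close>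
  have easy: "compact_open_values X \<mu> \<subseteq> compact_open_values cX ?\<nu> \<inter> {0..<emeasure \<mu> (topspace X)}"
  proof
    fix c assume "c \<in> compact_open_values X \<mu>"
    then obtain U where U: "compact_open X U" "emeasure \<mu> U < \<infinity>" "c = emeasure \<mu> U"
      by (auto simp: compact_open_values_def)
    then have "c < emeasure \<mu> (topspace X)"
      using emeasure_compact_open_less_topspace[OF X(1,3) sets full] by blast
    moreover have "c \<in> compact_open_values cX ?\<nu>"
      unfolding compact_open_values_def using U img[OF U(1)] emi[OF U(1)] by force
    ultimately show "c \<in> compact_open_values cX ?\<nu> \<inter> {0..<emeasure \<mu> (topspace X)}"
      by simp
  qed
  show ?thesis
  proof
    assume good: "good cX ?\<nu>"
    have "c \<in> compact_open_values X \<mu>"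
      if c: "c \<in> compact_open_values cX ?\<nu>" "c < emeasure \<mu> (topspace X)" for c
    proof -
      obtain V where V: "compact_open cX V" "emeasure ?\<nu> V < \<infinity>" "c = emeasure ?\<nu> V"
        using c(1) by (auto simp: compact_open_values_def)
      obtain U where U: "compact_open X U" "c < emeasure \<mu> U"
        using openin_less_emeasure_compact_open[OF assms(1) sets openin_topspace c(2)] .
      then obtain W where W: "compact_open cX W" "W \<subseteq> \<iota> ` U" "emeasure ?\<nu> W = c"
        using good V(1) V(3) img[OF U(1)] emi[OF U(1)] unfolding good_def by metis
      \<comment> \<open>\<open>W\<close> avoids the remainder because it was found inside the image
        of \<open>U\<close>, so it pulls back to a compact open set of \<open>X\<close>.\<close>
      have "W \<subseteq> \<iota> ` topspace X"
        using W(2) U(1) openin_subset[of X U] by (auto simp: compact_open_def)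
      then have "compact_open X (?T W)"
        using compact_open_vimage_embedding[OF emb W(1)] by blast
      then show ?thesis
        using em[OF W(1)] W(3) V by (auto simp: compact_open_values_def)
    qed
    then show "compact_open_values cX ?\<nu> \<inter> {0..<emeasure \<mu> (topspace X)} = compact_open_values X \<mu>"
      using easy by auto
  next
    assume eq: "compact_open_values cX ?\<nu> \<inter> {0..<emeasure \<mu> (topspace X)} = compact_open_values X \<mu>"
    have "\<exists>W. compact_open cX W \<and> W \<subseteq> V \<and> emeasure ?\<nu> W = emeasure ?\<nu> U"
      if U: "compact_open cX U" and V: "compact_open cX V" and less: "emeasure ?\<nu> U < emeasure ?\<nu> V"
      for U V
    proof -
      have "emeasure \<mu> (?T V) \<le> emeasure \<mu> (topspace X)"
        by (intro emeasure_mono) (auto simp: sets openin_in_sets_borel_of)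
      then have "emeasure ?\<nu> U < emeasure \<mu> (topspace X)"
        using less em[OF V] by simp
      \<comment> \<open>Only finite values are recorded in \<open>compact_open_values\<close>; a
        value strictly below another one is finite.\<close>
      moreover have "emeasure ?\<nu> U < \<infinity>"
        using less by (metis infinity_ennreal_def less_top order.strict_trans2 top_greatest)
      ultimately have "emeasure ?\<nu> U \<in> compact_open_values X \<mu>"
        using U eq by (auto simp: compact_open_values_def)
      \<comment> \<open>\<open>U\<close> may meet the remainder; \<open>U'\<close> replaces it by a
        set inside \<open>X\<close> with the same measure and need not be related to
        \<open>U\<close> otherwise.\<close>
      then obtain U' where U': "compact_open X U'" "emeasure \<mu> U' = emeasure ?\<nu> U"
        by (auto simp: compact_open_values_def)
      have "emeasure ?\<nu> U < emeasure \<mu> (?T V)"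
        using less em[OF V] by simp
      \<comment> \<open>The trace of \<open>V\<close> is open but possibly not compact, so goodness
        of \<mu> is applied to the smaller \<open>V'\<close>.\<close>
      then obtain V' where V': "compact_open X V'" "V' \<subseteq> ?T V" "emeasure ?\<nu> U < emeasure \<mu> V'"
        using openin_less_emeasure_compact_open[OF assms(1) sets traceo[OF V]] by blast
      obtain W where W: "compact_open X W" "W \<subseteq> V'" "emeasure \<mu> W = emeasure \<mu> U'"
        using assms(3) U' V' unfolding good_def by metis
      have "\<iota> ` W \<subseteq> V"
        using W(2) V'(2) by auto
      then show ?thesis
        using img[OF W(1)] emi[OF W(1)] W(3) U'(2) by metis
    qed
    then show "good cX ?\<nu>"
      using zero_extension_in_M0[OF assms(4) op assms(2)] unfolding good_def by blast
  qed
qed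

end
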